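(* Let $a,b\in\mathbb{R}$ with $a<b$ and $0\notin[a,b]$, and let $n\in\mathbb{Z}$ with $|n|\ge 2$. Then for all $p>1$, with $q=\frac{p}{p-1}$: (a) $$\left|A(a^n,b^n)-L_n^n(a,b)\right|\le |n|(b-a)\left(\frac{1}{p+1}\right)^{\frac1p}\left(\frac12\right)^{\frac1q}A\left(|a|^{n-1},|b|^{n-1}\right);$$ (b) $$\left|A(a^n,b^n)-L_n^n(a,b)\right|\le |n|(b-a)\,\frac{3^{1-\frac1q}}{4}\,A\left(|a|^{n-1},|b|^{n-1}\right).$$
   Context: For real $u,v$, $A(u,v)=\frac{u+v}{2}$ is the arithmetic mean. For $n\in\mathbb{Z}\setminus\{-1,0\}$ and real $a\ne b$, the generalized logarithmic mean is $L_n(a,b)=\left[\frac{b^{n+1}-a^{n+1}}{(b-a)(n+1)}\right]^{1/n}$, and $L_n^n(a,b)$ denotes its $n$-th power, i.e. $L_n^n(a,b)=\frac{b^{n+1}-a^{n+1}}{(b-a)(n+1)}$. *)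

theory Defs
  imports Complex_Main
begin

definition arith_mean :: "real \<Rightarrow> real \<Rightarrow> real" where
  "arith_mean u v = (u + v) / 2"

(* The real power x^(1/n) for a nonzero integer n. The operator powr is unsuitable:
   for odd n and negative a, b the argument is negative and the real odd root is meant. *)
definition int_root :: "int \<Rightarrow> real \<Rightarrow> real" where
  "int_root n x = (if n > 0 then root (nat n) x else inverse (root (nat (- n)) x))"

(* Meaningful for a \<noteq> b and n different from -1 and 0. *)
definition gen_log_mean :: "int \<Rightarrow> real \<Rightarrow> real \<Rightarrow> real" where
  "gen_log_mean n a b =
     int_root n ((b powi (n + 1) - a powi (n + 1)) / ((b - a) * (of_int n + 1)))"

lemma int_root_powi:
  assumes "n \<noteq> 0" and "odd n \<or> x \<ge> 0"
  shows "int_root n x powi n = x"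
proof -
  have root: "root k x ^ k = x" if "k > 0" "odd k \<or> x \<ge> 0" for k :: nat
    using that by (auto simp: odd_real_root_pow real_root_pow_pos2)
  show ?thesis
  proof (cases "n > 0")
    case True
    then show ?thesis
      using root[of "nat n"] assms by (auto simp: int_root_def power_int_def even_nat_iff)
  next
    case False
    then show ?thesis
      using root[of "nat (- n)"] assms
      by (auto simp: int_root_def power_int_def even_nat_iff power_inverse)
  qed
qed

lemma power_int_odd_mono:
  fixes a b :: real
  assumes "a \<le> b" and "0 \<notin> {a..b}" and "odd m"
  shows "if m > 0 then a powi m \<le> b powi m else b powi m \<le> a powi m"
proof (cases "m > 0")
  case True
  then show ?thesis
    using assms by (auto simp: power_int_def even_nat_iff intro!: power_mono_odd)
next
  case False
  have "a ^ nat (- m) \<le> b ^ nat (- m)"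
    using assms False by (intro power_mono_odd) (auto simp: even_nat_iff)
  moreover have "(a > 0 \<and> b > 0) \<or> (a < 0 \<and> b < 0)"
    using assms by auto
  ultimately have "inverse (b ^ nat (- m)) \<le> inverse (a ^ nat (- m))"
  proof (elim disjE)
    assume "a > 0 \<and> b > 0"
    then show "inverse (b ^ nat (- m)) \<le> inverse (a ^ nat (- m))"
      using \<open>a ^ nat (- m) \<le> b ^ nat (- m)\<close> by (intro le_imp_inverse_le) auto
  next
    assume "a < 0 \<and> b < 0"
    moreover have "odd (nat (- m))"
      using assms False by (auto simp: even_nat_iff)
    ultimately have "b ^ nat (- m) < 0"
      by (simp add: power_less_zero_eq)
    then show "inverse (b ^ nat (- m)) \<le> inverse (a ^ nat (- m))"
      using \<open>a ^ nat (- m) \<le> b ^ nat (- m)\<close> by (intro le_imp_inverse_le_neg) auto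
  qed
  then show ?thesis
    using False assms by (auto simp: power_int_def power_inverse)
qed

lemma gen_log_mean_powi:
  assumes "a < b" and "0 \<notin> {a..b}" and "n \<noteq> 0" and "n \<noteq> -1"
  shows "gen_log_mean n a b powi n =
           (b powi (n + 1) - a powi (n + 1)) / ((b - a) * (of_int n + 1))"
proof -
  let ?m = "(b powi (n + 1) - a powi (n + 1)) / ((b - a) * (of_int n + 1))"
  have "?m \<ge> 0" if "even n"
  proof (cases "n + 1 > 0")
    case True
    then have "(of_int n + 1 :: real) > 0" by linarith
    moreover have "a powi (n + 1) \<le> b powi (n + 1)"
      using power_int_odd_mono[of a b "n + 1"] assms that True by auto
    ultimately show ?thesis
      using assms by (intro divide_nonneg_pos mult_pos_pos) auto
  next
    case False
    then have "(of_int n + 1 :: real) < 0" using assms by linarith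
    moreover have "b powi (n + 1) \<le> a powi (n + 1)"
      using power_int_odd_mono[of a b "n + 1"] assms that False by auto
    ultimately show ?thesis
      using assms by (intro divide_nonpos_neg mult_pos_neg) auto
  qed
  then show ?thesis
    using assms unfolding gen_log_mean_def by (intro int_root_powi) auto
qed

end

theory Submission
  imports Defs "HOL-Analysis.Analysis"
begin

text \<open>
  With $c = (a+b)/2$ and an antiderivative $F$ of $f$, the function $(x-c) f(x) - F(x)$ has
  derivative $(x-c) f'(x)$, so the error of the trapezoid rule on $[a,b]$ is at most
  $\int_a^b |x-c| |f'(x)| dx$. If $|f'|$ is convex, bounding it by its chord gives the bound
  $(b-a)^2 (|f'(a)| + |f'(b)|)/8$. For $f(x) = x^n$ this is the claim with the constant $1/4$,
  which is smaller than both of the constants depending on $p$.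
\<close>

lemma trapezoid_error_bound:
  fixes f f' F :: "real \<Rightarrow> real"
  assumes "a < b"
    and F: "\<And>x. x \<in> {a..b} \<Longrightarrow> (F has_real_derivative f x) (at x)"
    and f: "\<And>x. x \<in> {a..b} \<Longrightarrow> (f has_real_derivative f' x) (at x)"
    and conv: "convex_on {a..b} (\<lambda>x. \<bar>f' x\<bar>)"
  shows "\<bar>(b - a) * ((f a + f b) / 2) - (F b - F a)\<bar> \<le> (b - a)\<^sup>2 * (\<bar>f' a\<bar> + \<bar>f' b\<bar>) / 8"
proof -
  define c where "c = (a + b) / 2"
  define h where "h = (b - a) / 2"
  define s where "s = (\<bar>f' b\<bar> - \<bar>f' a\<bar>) / (b - a)"
  define G where "G = (\<lambda>x. (x - c) * f x - F x)"
  define l where "l = (\<lambda>x. \<bar>f' a\<bar> + s * (x - a))"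
  \<comment> \<open>\<open>l\<close> is the chord of \<open>\<bar>f'\<bar>\<close> over
    \<open>{a..b}\<close>. With t = x - a, the product \<open>(c - x) * l x\<close> is (h - t)
    (|f'(a)| + s t); integrating this polynomial in t from 0 gives \<open>H\<close>, so
    \<open>H a\<close> = 0.\<close>
  define H where "H = (\<lambda>x. \<bar>f' a\<bar> * h * (x - a) + (s * h - \<bar>f' a\<bar>) * (x - a)\<^sup>2 / 2 - s * (x - a) ^ 3 / 3)"
  have ac: "a < c" "c < b"
    using \<open>a < b\<close> by (auto simp: c_def)
  have G: "(G has_real_derivative (x - c) * f' x) (at x)" if "x \<in> {a..b}" for x
    unfolding G_def using that
    by (auto intro!: derivative_eq_intros F f simp: algebra_simps)
  have H: "(H has_real_derivative (c - x) * l x) (at x)" for x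
    unfolding H_def l_def
    by (auto intro!: derivative_eq_intros simp: c_def h_def field_simps power2_eq_square)
  have chord: "\<bar>f' x\<bar> \<le> l x" if "x \<in> {a..b}" for x
    using convex_onD_Icc'[OF conv that] by (simp add: l_def s_def)
  have contG: "continuous_on {u..v} G" if "a \<le> u" "v \<le> b" for u v
    using that by (intro DERIV_continuous_on[OF DERIV_subset[OF G]]) auto
  have contH: "continuous_on S H" for S
    by (intro DERIV_continuous_on[OF DERIV_subset[OF H]]) auto
  \<comment> \<open>The integral estimate is replaced by the mean value inequality: |G'| is
    dominated by the derivative of an explicit function. Since |x - c| changes form at
    \<open>c\<close>, the dominating function is \<open>H\<close> on the left half and
    \<open>- H\<close> on the right half.\<close>
  have left: "norm (G c - G a) \<le> H c - H a"
  proof (rule differentiable_bound_general[where f' = "\<lambda>x. (x - c) * f' x" and \<phi>' = "\<lambda>x. (c - x) * l x"])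
    show "norm ((x - c) * f' x) \<le> (c - x) * l x" if "a < x" "x < c" for x
      using that ac chord[of x] by (simp add: abs_mult mult_left_mono)
  qed (use ac G H contG contH in \<open>auto simp: has_real_derivative_iff_has_vector_derivative[symmetric]\<close>)
  have right: "norm (G b - G c) \<le> (- H b) - (- H c)"
  proof (rule differentiable_bound_general[where f' = "\<lambda>x. (x - c) * f' x" and \<phi>' = "\<lambda>x. - ((c - x) * l x)"])
    show "norm ((x - c) * f' x) \<le> - ((c - x) * l x)" if "c < x" "x < b" for x
      using that ac mult_left_mono[OF chord[of x], of "x - c"]
      by (simp add: abs_mult flip: mult_minus_left)
    show "((\<lambda>x. - H x) has_vector_derivative - ((c - x) * l x)) (at x)" for x
      using DERIV_minus[OF H] by (simp add: has_real_derivative_iff_has_vector_derivative)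
  qed (use ac G contG contH in
        \<open>auto simp: has_real_derivative_iff_has_vector_derivative[symmetric] intro!: continuous_on_minus\<close>)
  have ba: "b - a = 2 * h" and ca: "c - a = h"
    by (auto simp: h_def c_def field_simps)
  have sh: "s * h = (\<bar>f' b\<bar> - \<bar>f' a\<bar>) / 2"
    using \<open>a < b\<close> by (simp add: s_def h_def)
  have "\<bar>G b - G a\<bar> \<le> 2 * H c - H a - H b"
    using left right by simp
  \<comment> \<open>At \<open>c\<close> and \<open>b\<close> the variable x - a of \<open>H\<close>
    takes the values h and 2h. The factor \<open>\<bar>f' a\<bar> + s * h\<close> is the height of
    the chord at the midpoint, that is, the mean of |f'(a)| and |f'(b)|.\<close>
  also have "\<dots> = h\<^sup>2 * (\<bar>f' a\<bar> + s * h)"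
    unfolding H_def ba ca by (simp add: field_simps power2_eq_square power3_eq_cube)
  also have "\<dots> = (b - a)\<^sup>2 * (\<bar>f' a\<bar> + \<bar>f' b\<bar>) / 8"
    unfolding sh by (simp add: h_def power2_eq_square field_simps)
  also have "G b - G a = (b - a) * ((f a + f b) / 2) - (F b - F a)"
    by (simp add: G_def c_def field_simps)
  finally show ?thesis .
qed

text \<open>A convex set avoiding 0 lies on one side of it, so there |x| = s x with a constant sign
  s. As s^2 = 1, the second derivative of (s x)^m is m (m - 1) (s x)^(m - 2), whose sign is that of
  m (m - 1).\<close>

lemma convex_on_abs_powi:
  fixes C :: "real set" and m :: int
  assumes "convex C" and "0 \<notin> C" and m: "m * (m - 1) \<ge> 0"
  shows "convex_on C (\<lambda>x. \<bar>x\<bar> powi m)"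
proof -
  have "(\<forall>x\<in>C. x > 0) \<or> (\<forall>x\<in>C. x < 0)"
  proof (rule ccontr)
    assume "\<not> ?thesis"
    then obtain x y where "x \<in> C" "x \<le> 0" "y \<in> C" "0 \<le> y"
      by force
    then have "0 \<in> C"
      using \<open>convex C\<close> by (meson connectedD_interval convex_connected)
    then show False
      using \<open>0 \<notin> C\<close> by contradiction
  qed
  then obtain s :: real where s: "s * s = 1" "\<And>x. x \<in> C \<Longrightarrow> \<bar>x\<bar> = s * x" "\<And>x. x \<in> C \<Longrightarrow> s * x > 0"
  proof (elim disjE)
    assume "\<forall>x\<in>C. x > 0"
    then show ?thesis by (intro that[of 1]) auto
  next
    assume "\<forall>x\<in>C. x < 0"
    then show ?thesis by (intro that[of "-1"]) auto
  qed
  have "convex_on C (\<lambda>x. (s * x) powi m)"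
  proof (rule f''_ge0_imp_convex[OF \<open>convex C\<close>])
    fix x assume "x \<in> C"
    then have pos: "s * x > 0" by (rule s)
    show "((\<lambda>x. (s * x) powi m) has_real_derivative of_int m * (s * x) powi (m - 1) * s) (at x)"
      using pos by (auto intro!: derivative_eq_intros)
    show "((\<lambda>x. of_int m * (s * x) powi (m - 1) * s) has_real_derivative
        of_int (m * (m - 1)) * (s * x) powi (m - 2) * (s * s)) (at x)"
      using pos by (auto intro!: derivative_eq_intros simp: algebra_simps)
    show "of_int (m * (m - 1)) * (s * x) powi (m - 2) * (s * s) \<ge> 0"
      unfolding s(1) using pos m by (intro mult_nonneg_nonneg) (auto simp del: of_int_mult)
  qed
  then show ?thesis
    using s(2) \<open>convex C\<close> by (simp add: convex_on_def convex_def)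
qed

text \<open>This is the trapezoid bound for x^n, divided by b - a > 0. Hypothesis \<open>n\<close>
  is the convexity criterion for |x|^m at m = n - 1, and \<open>n \<noteq> -1\<close> makes x^(n +
  1) / (n + 1) an antiderivative.\<close>

lemma powi_trapezoid_error_bound:
  fixes a b :: real and n :: int
  assumes "a < b" and "0 \<notin> {a..b}" and "n \<noteq> -1" and n: "(n - 1) * (n - 2) \<ge> 0"
  shows "\<bar>arith_mean (a powi n) (b powi n)
            - (b powi (n + 1) - a powi (n + 1)) / ((b - a) * (of_int n + 1))\<bar>
           \<le> of_int \<bar>n\<bar> * (b - a) / 4 * arith_mean (\<bar>a\<bar> powi (n - 1)) (\<bar>b\<bar> powi (n - 1))"
    (is "\<bar>?E\<bar> \<le> ?R")
proof -
  have n1: "of_int n + 1 \<noteq> (0 :: real)"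
    using \<open>n \<noteq> -1\<close> by linarith
  let ?F = "\<lambda>x :: real. x powi (n + 1) / (of_int n + 1)"
  let ?f' = "\<lambda>x :: real. of_int n * x powi (n - 1)"
  have abs_f': "\<bar>?f' x\<bar> = of_int \<bar>n\<bar> * \<bar>x\<bar> powi (n - 1)" for x
    by (simp add: abs_mult power_int_abs)
  have "\<bar>(b - a) * ((a powi n + b powi n) / 2) - (?F b - ?F a)\<bar>
      \<le> (b - a)\<^sup>2 * (\<bar>?f' a\<bar> + \<bar>?f' b\<bar>) / 8"
  proof (rule trapezoid_error_bound[OF \<open>a < b\<close>])
    fix x assume "x \<in> {a..b}"
    then have "x \<noteq> 0" using assms by auto
    then show "(?F has_real_derivative x powi n) (at x)"
      using n1 by (auto intro!: derivative_eq_intros)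
    show "((\<lambda>x. x powi n) has_real_derivative ?f' x) (at x)"
      using \<open>x \<noteq> 0\<close> by (auto intro!: derivative_eq_intros)
  next
    show "convex_on {a..b} (\<lambda>x. \<bar>?f' x\<bar>)"
      unfolding abs_f' using assms by (intro convex_on_cmul convex_on_abs_powi) auto
  qed
  also have "(b - a) * ((a powi n + b powi n) / 2) - (?F b - ?F a) = (b - a) * ?E"
  proof -
    have "(b - a) * ((b powi (n + 1) - a powi (n + 1)) / ((b - a) * (of_int n + 1))) = ?F b - ?F a"
      using \<open>a < b\<close> by (simp flip: diff_divide_distrib)
    then show ?thesis
      by (simp only: arith_mean_def right_diff_distrib)
  qed
  also have "(b - a)\<^sup>2 * (\<bar>?f' a\<bar> + \<bar>?f' b\<bar>) / 8 = (b - a) * ?R"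
    unfolding abs_f' by (simp add: arith_mean_def power2_eq_square algebra_simps)
  finally show ?thesis
    using \<open>a < b\<close> by (simp add: abs_mult)
qed

text \<open>Substituting 1/q = 1 - 1/p turns the right-hand side into (2 / (p + 1))^(1/p) / 2. Hence
  it suffices that (p + 1) / 2 <= 2^p, which follows from 2^p >= 1 + p ln 2 and ln 2 >= 1/2.\<close>

lemma quarter_le_powr:
  fixes p q :: real
  assumes "p > 0" and q: "1 / q = 1 - 1 / p"
  shows "1 / 4 \<le> (1 / (p + 1)) powr (1 / p) * (1 / 2) powr (1 / q)"
proof -
  \<comment> \<open>This is ln y <= y - 1 at y = 1/2.\<close>
  have "ln (2 :: real) \<ge> 1 / 2"
    using ln_le_minus_one[of "1 / 2 :: real"] by (simp add: ln_div)
  then have "1 + p * (1 / 2) \<le> 1 + p * ln 2"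
    using \<open>p > 0\<close> by (intro add_left_mono mult_left_mono) auto
  also have "\<dots> \<le> 2 powr p"
    using exp_ge_add_one_self[of "p * ln 2"] by (simp add: powr_def)
  finally have "(p + 1) / 2 \<le> 2 powr p"
    by simp
  then have "1 / 2 powr p \<le> 2 / (p + 1)"
    using \<open>p > 0\<close> by (simp add: field_simps)
  then have "(1 / 2 powr p) powr (1 / p) \<le> (2 / (p + 1)) powr (1 / p)"
    using \<open>p > 0\<close> by (intro powr_mono2) auto
  moreover have "(1 / 2 powr p) powr (1 / p) = 1 / 2"
    using \<open>p > 0\<close> by (simp add: powr_divide powr_powr)
  moreover have "(1 / (p + 1)) powr (1 / p) * (1 / 2) powr (1 / q)
      = (2 / (p + 1)) powr (1 / p) * (1 / 2)"
    unfolding q using \<open>p > 0\<close> by (simp add: powr_divide powr_diff)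
  ultimately show ?thesis
    by simp
qed

theorem proposition1:
  fixes a b p q :: real and n :: int
  assumes "a < b" and "0 \<notin> {a..b}" and "\<bar>n\<bar> \<ge> 2"
    and "p > 1" and "q = p / (p - 1)"
  shows "\<bar>arith_mean (a powi n) (b powi n) - gen_log_mean n a b powi n\<bar>
           \<le> of_int \<bar>n\<bar> * (b - a) * (1 / (p + 1)) powr (1 / p) * (1 / 2) powr (1 / q)
              * arith_mean (\<bar>a\<bar> powi (n - 1)) (\<bar>b\<bar> powi (n - 1)) \<and>
         \<bar>arith_mean (a powi n) (b powi n) - gen_log_mean n a b powi n\<bar>
           \<le> of_int \<bar>n\<bar> * (b - a) * (3 powr (1 - 1 / q) / 4)
              * arith_mean (\<bar>a\<bar> powi (n - 1)) (\<bar>b\<bar> powi (n - 1))"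
proof -
  let ?E = "\<bar>arith_mean (a powi n) (b powi n) - gen_log_mean n a b powi n\<bar>"
  let ?A = "arith_mean (\<bar>a\<bar> powi (n - 1)) (\<bar>b\<bar> powi (n - 1))"
  have q: "1 / q = 1 - 1 / p"
    using assms by (simp add: diff_divide_distrib)
  \<comment> \<open>Either n >= 2 and both factors are nonnegative, or n <= -2 and both are
    negative.\<close>
  have "(n - 1) * (n - 2) \<ge> 0"
    using \<open>\<bar>n\<bar> \<ge> 2\<close> by (auto simp: zero_le_mult_iff)
  then have "?E \<le> of_int \<bar>n\<bar> * (b - a) / 4 * ?A"
    using powi_trapezoid_error_bound[of a b n] gen_log_mean_powi[of a b n] assms by auto
  then have E: "?E \<le> (of_int \<bar>n\<bar> * (b - a) * ?A) * (1 / 4)"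
    by simp
  \<comment> \<open>With a nonnegative common factor, the constant 1/4 in \<open>E\<close> can be
    replaced by any larger one.\<close>
  have nonneg: "of_int \<bar>n\<bar> * (b - a) * ?A \<ge> 0"
    using \<open>a < b\<close> by (auto simp: arith_mean_def)
  have "?E \<le> (of_int \<bar>n\<bar> * (b - a) * ?A) * ((1 / (p + 1)) powr (1 / p) * (1 / 2) powr (1 / q))"
    using E by (rule order_trans[OF _ mult_left_mono[OF quarter_le_powr nonneg]])
      (use \<open>p > 1\<close> q in auto)
  \<comment> \<open>The exponent 1 - 1/q equals 1/p > 0, so the power of 3 is at least 1.\<close>
  moreover have "1 / 4 \<le> 3 powr (1 - 1 / q) / 4"
    unfolding q using \<open>p > 1\<close> by (simp add: ge_one_powr_ge_zero)
  then have "?E \<le> (of_int \<bar>n\<bar> * (b - a) * ?A) * (3 powr (1 - 1 / q) / 4)"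
    using E by (rule order_trans[OF _ mult_left_mono[OF _ nonneg], rotated])
  ultimately show ?thesis
    by (simp only: mult_ac)
qed

end
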